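(* Let $\{S(t)\}_{t\ge0}$ be a twin semigroup on a norming dual pair $(Y,Y^\diamond)$. Assume that every sequentially continuous linear map $(Y,\sigma(Y,Y^\diamond))\to\mathbb R$ is continuous. Let $q^\diamond\in Y^\diamond$ and let $F:[0,\infty)\to\mathbb R$ be of locally bounded variation. Then, for each $t>0$, there exists $u^\diamond(t)\in Y^\diamond$ such that for all $y\in Y$ $$\int_{[0,t]}F(d\tau)\;q^\diamond S(t-\tau)y=\langle u^\diamond(t),y\rangle .$$
   Context: Banach spaces $Y,Y^\diamond$ (real) form a norming dual pair if there is a bilinear map $\langle\cdot,\cdot\rangle:Y^\diamond\times Y\to\mathbb R$ with $|\langle y^\diamond,y\rangle|\le M\|y^\diamond\|\|y\|$ for some $M\ge1$, $\|y\|=\sup\{|\langle y^\diamond,y\rangle|:\|y^\diamond\|\le1\}$ and $\|y^\diamond\|=\sup\{|\langle y^\diamond,y\rangle|:\|y\|\le1\}$. $\sigma(Y,Y^\diamond)$ is the weak topology on $Y$ induced by $Y^\diamond$. A twin operator $L$ is a bounded bilinear map $Y^\diamond\times Y\to\mathbb R$, $(y^\diamond,y)\mapsto y^\diamond Ly$, such that for each $y$ there is $Ly\in Y$ with $\langle y^\diamond,Ly\rangle=y^\diamond Ly$ for all $y^\diamond$, and for each $y^\diamond$ there is $y^\diamond L\in Y^\diamond$ with $\langle y^\diamond L,y\rangle=y^\diamond Ly$ for all $y$. Composition: $y^\diamond L_1L_2y:=\langle y^\diamond L_1,L_2y\rangle$. A twin semigroup is a family $\{S(t)\}_{t\ge0}$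 of twin operators with: (i) $S(0)=I$, $S(t+s)=S(t)S(s)$; (ii) $|y^\diamond S(t)y|\le Me^{\omega t}\|y\|\|y^\diamond\|$ for some $M\ge1,\omega\in\mathbb R$; (iii) $t\mapsto y^\diamond S(t)y$ is Borel measurable for all $y,y^\diamond$; (iv) for $\operatorname{Re}\lambda>\omega$ there is a twin operator $\overline S(\lambda)$ (on the complexification if $\lambda$ is non-real) with $y^\diamond\overline S(\lambda)y=\int_0^\infty e^{-\lambda t}y^\diamond S(t)y\,dt$. Functions of locally bounded variation are normalized: $F(0)=0$ and $F$ right-continuous on $(0,\infty)$; $F(d\tau)$ is the Lebesgue–Stieltjes (Radon) measure on $[0,\infty)$ that assigns $F(t)$ to $[0,t]$ for $t>0$. *)

theory Defs
  imports "HOL-Analysis.Analysis"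
begin

section \<open>Norming dual pairs\<close>

text \<open>Throughout, the pairing takes its arguments in the order \<open>B y' y\<close>, with \<open>y'\<close> in the space
  written with a diamond.\<close>

definition norming_dual_pair :: "('d::banach \<Rightarrow> 'y::banach \<Rightarrow> real) \<Rightarrow> bool" where
  "norming_dual_pair B \<longleftrightarrow>
     bilinear B \<and>
     (\<exists>M\<ge>1. \<forall>y' y. \<bar>B y' y\<bar> \<le> M * norm y' * norm y) \<and>
     (\<forall>y. norm y = (SUP y'\<in>{y'. norm y' \<le> 1}. \<bar>B y' y\<bar>)) \<and>
     (\<forall>y'. norm y' = (SUP y\<in>{y. norm y \<le> 1}. \<bar>B y' y\<bar>))"

definition weak_topology :: "('d \<Rightarrow> 'y \<Rightarrow> real) \<Rightarrow> 'y topology" where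
  "weak_topology B = topology_generated_by {{y. B y' y \<in> U} | y' U. open U}"

definition sequentially_continuous_map :: "'a topology \<Rightarrow> 'b topology \<Rightarrow> ('a \<Rightarrow> 'b) \<Rightarrow> bool" where
  "sequentially_continuous_map X Y f \<longleftrightarrow>
     f \<in> topspace X \<rightarrow> topspace Y \<and>
     (\<forall>x l. (\<forall>n. x n \<in> topspace X) \<and> limitin X x l sequentially
        \<longrightarrow> limitin Y (\<lambda>n. f (x n)) (f l) sequentially)"

section \<open>Twin operators\<close>

definition twin_operator ::
    "('d::real_normed_vector \<Rightarrow> 'y::real_normed_vector \<Rightarrow> real) \<Rightarrow> ('d \<Rightarrow> 'y \<Rightarrow> real) \<Rightarrow> bool" where
  "twin_operator B L \<longleftrightarrow>
     bounded_bilinear L \<and>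
     (\<forall>y. \<exists>z. \<forall>y'. B y' z = L y' y) \<and>
     (\<forall>y'. \<exists>z'. \<forall>y. B z' y = L y' y)"

definition twin_right :: "('d \<Rightarrow> 'y \<Rightarrow> real) \<Rightarrow> ('d \<Rightarrow> 'y \<Rightarrow> real) \<Rightarrow> 'y \<Rightarrow> 'y" where
  "twin_right B L y = (THE z. \<forall>y'. B y' z = L y' y)"

definition twin_left :: "('d \<Rightarrow> 'y \<Rightarrow> real) \<Rightarrow> ('d \<Rightarrow> 'y \<Rightarrow> real) \<Rightarrow> 'd \<Rightarrow> 'd" where
  "twin_left B L y' = (THE z'. \<forall>y. B z' y = L y' y)"

definition twin_comp ::
    "('d \<Rightarrow> 'y \<Rightarrow> real) \<Rightarrow> ('d \<Rightarrow> 'y \<Rightarrow> real) \<Rightarrow> ('d \<Rightarrow> 'y \<Rightarrow> real) \<Rightarrow> 'd \<Rightarrow> 'y \<Rightarrow> real" where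
  "twin_comp B L1 L2 y' y = B (twin_left B L1 y') (twin_right B L2 y)"

text \<open>The complexification of a real space is its square, with \<open>(u, v)\<close> standing for \<open>u + \<i>v\<close>.
  The product norm is real-homogeneous only, but it is equivalent to each of the usual norms on the
  complexification, so boundedness of a bilinear map does not depend on this choice.\<close>

definition complexification_scale :: "complex \<Rightarrow> 'a::real_vector \<times> 'a \<Rightarrow> 'a \<times> 'a" where
  "complexification_scale c p =
     (Re c *\<^sub>R fst p - Im c *\<^sub>R snd p, Re c *\<^sub>R snd p + Im c *\<^sub>R fst p)"

definition complexify :: "('d \<Rightarrow> 'y \<Rightarrow> real) \<Rightarrow> 'd \<times> 'd \<Rightarrow> 'y \<times> 'y \<Rightarrow> complex" where
  "complexify L p q =
     Complex (L (fst p) (fst q) - L (snd p) (snd q)) (L (fst p) (snd q) + L (snd p) (fst q))"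

definition complex_twin_operator ::
    "('d::real_normed_vector \<Rightarrow> 'y::real_normed_vector \<Rightarrow> real)
       \<Rightarrow> ('d \<times> 'd \<Rightarrow> 'y \<times> 'y \<Rightarrow> complex) \<Rightarrow> bool" where
  "complex_twin_operator B L \<longleftrightarrow>
     bounded_bilinear L \<and>
     (\<forall>c y' y. L (complexification_scale c y') y = c * L y' y) \<and>
     (\<forall>c y' y. L y' (complexification_scale c y) = c * L y' y) \<and>
     (\<forall>y. \<exists>z. \<forall>y'. complexify B y' z = L y' y) \<and>
     (\<forall>y'. \<exists>z'. \<forall>y. complexify B z' y = L y' y)"

section \<open>Twin semigroups\<close>

text \<open>Only the values \<open>S t\<close> with \<open>t \<ge> 0\<close> matter. The identity operator, regarded as a bilinear
  map, is the pairing itself.\<close>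

definition twin_semigroup ::
    "('d::banach \<Rightarrow> 'y::banach \<Rightarrow> real) \<Rightarrow> (real \<Rightarrow> 'd \<Rightarrow> 'y \<Rightarrow> real) \<Rightarrow> bool" where
  "twin_semigroup B S \<longleftrightarrow>
     (\<forall>t\<ge>0. twin_operator B (S t)) \<and>
     S 0 = B \<and>
     (\<forall>t\<ge>0. \<forall>s\<ge>0. S (t + s) = twin_comp B (S t) (S s)) \<and>
     (\<forall>y' y. set_borel_measurable borel {0..} (\<lambda>t. S t y' y)) \<and>
     (\<exists>M\<ge>1. \<exists>\<omega>::real.
        (\<forall>t\<ge>0. \<forall>y' y. \<bar>S t y' y\<bar> \<le> M * exp (\<omega> * t) * norm y * norm y') \<and>
        (\<forall>l::real. l > \<omega> \<longrightarrow>
           (\<exists>R. twin_operator B R \<and>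
              (\<forall>y' y. R y' y = (LBINT t:{0..}. exp (- l * t) * S t y' y)))) \<and>
        (\<forall>l::complex. Re l > \<omega> \<and> Im l \<noteq> 0 \<longrightarrow>
           (\<exists>R. complex_twin_operator B R \<and>
              (\<forall>y' y. R y' y =
                 (LBINT t:{0..}. exp (- l * complex_of_real t) * complexify (S t) y' y)))))"

section \<open>Functions of locally bounded variation and their Stieltjes measures\<close>

definition variation_along :: "(real \<Rightarrow> real) \<Rightarrow> real list \<Rightarrow> real" where
  "variation_along F xs = (\<Sum>(s, u)\<leftarrow>zip xs (tl xs). \<bar>F u - F s\<bar>)"

definition partitions :: "real \<Rightarrow> real \<Rightarrow> real list set" where
  "partitions a b = {xs. sorted xs \<and> set xs \<subseteq> {a..b}}"

definition total_variation :: "(real \<Rightarrow> real) \<Rightarrow> real \<Rightarrow> real" where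
  "total_variation F t = (SUP xs\<in>partitions 0 t. variation_along F xs)"

text \<open>Functions on the half-line \<open>{0..}\<close> are represented by functions on the reals whose values at
  negative arguments are ignored. Right-continuity at \<open>0\<close> is not required.\<close>

definition normalized_locally_BV :: "(real \<Rightarrow> real) \<Rightarrow> bool" where
  "normalized_locally_BV F \<longleftrightarrow>
     (\<forall>t\<ge>0. bdd_above (variation_along F ` partitions 0 t)) \<and>
     F 0 = 0 \<and> (\<forall>t>0. continuous (at_right t) F)"

text \<open>For nondecreasing \<open>G\<close> with \<open>G 0 = 0\<close>, the measure on the half-line giving mass \<open>G t\<close> to
  \<open>{0..t}\<close> for \<open>t > 0\<close>. The value of the distribution function at \<open>0\<close> is set to \<open>G(0+)\<close>, so a jump
  of \<open>G\<close> at \<open>0\<close> becomes an atom at \<open>0\<close>.\<close>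

definition halfline_cdf :: "(real \<Rightarrow> real) \<Rightarrow> real \<Rightarrow> real" where
  "halfline_cdf G x = (if x < 0 then 0 else if x = 0 then Lim (at_right 0) G else G x)"

definition halfline_measure :: "(real \<Rightarrow> real) \<Rightarrow> real measure" where
  "halfline_measure G = interval_measure (halfline_cdf G)"

text \<open>The signed measure \<open>F(d\<tau>)\<close> is represented by its Jordan decomposition, coming from the
  positive and negative variation of \<open>F\<close>; see \<open>stieltjes_Icc\<close> below.\<close>

definition stieltjes_pos :: "(real \<Rightarrow> real) \<Rightarrow> real measure" where
  "stieltjes_pos F = halfline_measure (\<lambda>t. (total_variation F t + F t) / 2)"

definition stieltjes_neg :: "(real \<Rightarrow> real) \<Rightarrow> real measure" where
  "stieltjes_neg F = halfline_measure (\<lambda>t. (total_variation F t - F t) / 2)"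

definition stieltjes_integral :: "(real \<Rightarrow> real) \<Rightarrow> real set \<Rightarrow> (real \<Rightarrow> real) \<Rightarrow> real" where
  "stieltjes_integral F A f =
     (LINT \<tau>:A|stieltjes_pos F. f \<tau>) - (LINT \<tau>:A|stieltjes_neg F. f \<tau>)"

lemma variation_along_simps [simp]:
  "variation_along F [] = 0" "variation_along F [x] = 0"
  "variation_along F (x # y # xs) = \<bar>F y - F x\<bar> + variation_along F (y # xs)"
  by (simp_all add: variation_along_def)

lemma variation_along_nonneg: "variation_along F xs \<ge> 0"
  unfolding variation_along_def by (rule sum_list_nonneg) auto

lemma variation_along_join:
  "variation_along F (xs @ x # ys) = variation_along F (xs @ [x]) + variation_along F (x # ys)"
proof (induction xs)
  case (Cons a xs)
  then show ?case by (cases xs) auto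
qed auto

lemma variation_along_Cons_ge: "variation_along F xs \<le> variation_along F (x # xs)"
  by (cases xs) auto

lemma variation_along_snoc_ge: "variation_along F xs \<le> variation_along F (xs @ [x])"
proof (induction xs)
  case (Cons a xs)
  then show ?case by (cases xs) auto
qed auto

lemma variation_along_insert:
  "variation_along F (xs @ ys) \<le> variation_along F (xs @ x # ys)"
proof (induction xs)
  case Nil
  then show ?case by (simp add: variation_along_Cons_ge)
next
  case (Cons a xs)
  then show ?case by (cases xs; cases ys) auto
qed

context
  fixes F :: "real \<Rightarrow> real"
  assumes F: "normalized_locally_BV F"
begin

lemma variation_along_le:
  assumes "xs \<in> partitions 0 t" shows "variation_along F xs \<le> total_variation F t"
proof (cases "t \<ge> 0")
  case True
  then show ?thesis
    using F assms unfolding total_variation_def normalized_locally_BV_def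
    by (intro cSUP_upper) auto
next
  case False
  then have "partitions 0 t = {[]}" by (auto simp: partitions_def)
  then show ?thesis using assms by (simp add: total_variation_def)
qed

lemma total_variation_superadd:
  assumes "0 \<le> s" "sorted (s # ys)" "set (s # ys) \<subseteq> {0..t}"
  shows "total_variation F s + variation_along F (s # ys) \<le> total_variation F t"
proof -
  have "total_variation F s \<le> total_variation F t - variation_along F (s # ys)"
    unfolding total_variation_def [of F s]
  proof (rule cSUP_least)
    show "partitions 0 s \<noteq> {}" by (auto simp: partitions_def intro: exI [of _ "[]"])
    fix xs assume xs: "xs \<in> partitions 0 s"
    have "xs @ s # ys \<in> partitions 0 t"
      using xs assms by (force simp: partitions_def sorted_append)
    then have "variation_along F (xs @ s # ys) \<le> total_variation F t"
      by (rule variation_along_le)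
    then show "variation_along F xs \<le> total_variation F t - variation_along F (s # ys)"
      using variation_along_join [of F xs s ys] variation_along_snoc_ge [of F xs s] by linarith
  qed
  then show ?thesis by simp
qed

lemma total_variation_increment:
  assumes "0 \<le> s" "s \<le> t"
  shows "\<bar>F t - F s\<bar> \<le> total_variation F t - total_variation F s"
  using total_variation_superadd [of s "[t]" t] assms by simp

lemma total_variation_0: "total_variation F 0 = 0"
proof (rule antisym)
  have "variation_along F xs \<le> 0" if "set xs \<subseteq> {0}" for xs :: "real list"
    using that
  proof (induction xs)
    case (Cons a xs)
    then show ?case by (cases xs) auto
  qed auto
  then show "total_variation F 0 \<le> 0"
    unfolding total_variation_def
    by (intro cSUP_least) (auto simp: partitions_def intro: exI [of _ "[]"])
  show "0 \<le> total_variation F 0"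
    using variation_along_le [of "[]" 0] by (simp add: partitions_def)
qed

lemma total_variation_right_continuous:
  assumes "x > 0" shows "continuous (at_right x) (total_variation F)"
proof -
  have "((\<lambda>y. total_variation F y) \<longlongrightarrow> total_variation F x) (at_right x)"
  proof (rule tendstoI)
    fix e :: real assume "e > 0"
    define b where "b = x + 1"
    have "\<exists>ps\<in>partitions 0 b. total_variation F b - e / 2 < variation_along F ps"
    proof -
      have "[] \<in> partitions 0 b" by (simp add: partitions_def)
      moreover have "bdd_above (variation_along F ` partitions 0 b)"
        using F \<open>x > 0\<close> by (auto simp: normalized_locally_BV_def b_def)
      ultimately have "c < total_variation F b \<longleftrightarrow> (\<exists>ps\<in>partitions 0 b. c < variation_along F ps)" for c
        unfolding total_variation_def by (intro less_cSUP_iff) auto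
      then show ?thesis using \<open>e > 0\<close> by (metis diff_less_eq half_gt_zero less_add_same_cancel1)
    qed
    then obtain ps where ps: "ps \<in> partitions 0 b"
      and gt: "total_variation F b - e / 2 < variation_along F ps" by blast
    define L R where "L = takeWhile (\<lambda>u. u \<le> x) ps" and "R = dropWhile (\<lambda>u. u \<le> x) ps"
    have LR: "ps = L @ R" by (simp add: L_def R_def)
    have sL: "sorted L" "sorted R" and sub: "set L \<subseteq> {0..b}" "set R \<subseteq> {0..b}"
      using ps unfolding LR by (auto simp: partitions_def sorted_append)
    have Lle: "\<forall>u\<in>set L. u \<le> x"
      using set_takeWhileD by (force simp: L_def)
    have Rgt: "\<forall>u\<in>set R. u > x"
    proof (cases R)
      case (Cons r R')
      then have "r > x" using hd_dropWhile [of "\<lambda>u. u \<le> x" ps] by (auto simp: R_def)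
      then show ?thesis using sL Cons by auto
    qed auto
    define m where "m = Min (insert b (set R))"
    have "m > x" using Rgt by (auto simp: m_def b_def)
    have est: "total_variation F y < total_variation F x + \<bar>F y - F x\<bar> + e / 2"
      if y: "x < y" "y < m" for y
    proof -
      have yR: "\<forall>u\<in>set R. y \<le> u" "y \<le> b" using y by (auto simp: m_def)
      have "L @ [x] \<in> partitions 0 x"
        using sL sub Lle \<open>x > 0\<close> by (auto simp: partitions_def sorted_append)
      then have 1: "variation_along F (L @ [x]) \<le> total_variation F x"
        by (rule variation_along_le)
      have 2: "total_variation F y + variation_along F (y # R) \<le> total_variation F b"
        using y yR \<open>x > 0\<close> sL sub by (intro total_variation_superadd) auto
      have "variation_along F ps \<le> variation_along F (L @ x # R)"
        unfolding LR by (rule variation_along_insert)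
      also have "\<dots> = variation_along F (L @ [x]) + variation_along F (x # R)"
        by (rule variation_along_join)
      also have "variation_along F (x # R) \<le> variation_along F (x # y # R)"
        using variation_along_insert [of F "[x]" R y] by simp
      finally show ?thesis using 1 2 gt by simp
    qed
    have "(F \<longlongrightarrow> F x) (at_right x)"
      using F \<open>x > 0\<close> by (simp add: normalized_locally_BV_def continuous_within)
    then have "\<forall>\<^sub>F y in at_right x. dist (F y) (F x) < e / 2"
      using \<open>e > 0\<close> by (intro tendstoD) auto
    moreover have "\<forall>\<^sub>F y in at_right x. y \<in> {x<..<m}"
      using \<open>m > x\<close> by (rule eventually_at_right_real)
    ultimately show "\<forall>\<^sub>F y in at_right x. dist (total_variation F y) (total_variation F x) < e"
    proof eventually_elim
      case (elim y)
      then show ?case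
        using est [of y] total_variation_increment [of x y] \<open>x > 0\<close> by (auto simp: dist_real_def)
    qed
  qed
  then show ?thesis by (simp add: continuous_within)
qed

end

context
  fixes G :: "real \<Rightarrow> real"
  assumes mono: "\<And>s t. 0 \<le> s \<Longrightarrow> s \<le> t \<Longrightarrow> G s \<le> G t"
    and zero: "G 0 = 0"
    and right_cont: "\<And>t. t > 0 \<Longrightarrow> continuous (at_right t) G"
begin

lemma halfline_fun_nonneg: "0 \<le> G s" if "0 \<le> s"
  using mono [of 0 s] that unfolding zero by blast

lemma halfline_fun_bdd_below: "bdd_below (G ` {0<..})"
  by (rule bdd_belowI [of _ 0]) (auto intro!: halfline_fun_nonneg)

lemma halfline_fun_right_limit_0: "(G \<longlongrightarrow> (INF s\<in>{0<..}. G s)) (at_right 0)"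
proof -
  show ?thesis
  proof (rule tendstoI)
    fix e :: real assume "e > 0"
    then obtain s where s: "s > 0" "G s < (INF s\<in>{0<..}. G s) + e"
      using cINF_less_iff [of "{0::real<..}" G "(INF s\<in>{0<..}. G s) + e"] halfline_fun_bdd_below by auto
    have "\<forall>\<^sub>F y in at_right 0. y \<in> {0<..<s}"
      using s by (intro eventually_at_right_real)
    then show "\<forall>\<^sub>F y in at_right 0. dist (G y) (INF s\<in>{0<..}. G s) < e"
    proof eventually_elim
      case (elim y)
      have "(INF s\<in>{0<..}. G s) \<le> G y" using halfline_fun_bdd_below elim by (intro cINF_lower) auto
      then show ?case using mono [of y s] s elim by (auto simp: dist_real_def)
    qed
  qed
qed

lemma halfline_cdf_0: "halfline_cdf G 0 = (INF s\<in>{0<..}. G s)"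
  using tendsto_Lim [OF _ halfline_fun_right_limit_0] by (simp add: halfline_cdf_def)

lemma halfline_cdf_mono: "x \<le> y \<Longrightarrow> halfline_cdf G x \<le> halfline_cdf G y"
proof -
  assume "x \<le> y"
  have "0 \<le> halfline_cdf G 0"
    unfolding halfline_cdf_0 by (rule cINF_greatest) (auto intro: halfline_fun_nonneg)
  moreover have "halfline_cdf G 0 \<le> G s" if "s > 0" for s
    unfolding halfline_cdf_0 using halfline_fun_bdd_below that by (intro cINF_lower) auto
  ultimately show ?thesis
    using \<open>x \<le> y\<close> mono [of x y] halfline_fun_nonneg [of y]
    by (cases x "0::real" rule: linorder_cases; cases y "0::real" rule: linorder_cases)
       (force simp: halfline_cdf_def)+
qed

lemma halfline_cdf_right_cont: "continuous (at_right x) (halfline_cdf G)"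
proof (cases x "0::real" rule: linorder_cases)
  case less
  have "\<forall>\<^sub>F y in at_right x. halfline_cdf G y = 0"
    using eventually_at_right_real [OF less] by eventually_elim (auto simp: halfline_cdf_def)
  then have "(halfline_cdf G \<longlongrightarrow> 0) (at_right x)" by (rule tendsto_eventually)
  then show ?thesis using less by (simp add: continuous_within halfline_cdf_def)
next
  case equal
  have "\<forall>\<^sub>F y in at_right 0. G y = halfline_cdf G y"
    by (auto simp: halfline_cdf_def eventually_at_filter)
  then have "(halfline_cdf G \<longlongrightarrow> halfline_cdf G 0) (at_right 0)"
    using halfline_fun_right_limit_0 unfolding halfline_cdf_0 by (rule Lim_transform_eventually [rotated])
  then show ?thesis using equal by (simp add: continuous_within)
next
  case greater
  have "\<forall>\<^sub>F y in at_right x. G y = halfline_cdf G y"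
    using greater by (auto simp: halfline_cdf_def eventually_at_filter)
  moreover have "(G \<longlongrightarrow> halfline_cdf G x) (at_right x)"
    using right_cont [OF greater] greater by (simp add: continuous_within halfline_cdf_def)
  ultimately have "(halfline_cdf G \<longlongrightarrow> halfline_cdf G x) (at_right x)"
    by (rule Lim_transform_eventually [rotated])
  then show ?thesis by (simp add: continuous_within)
qed

lemma emeasure_halfline_measure_Icc:
  assumes "t > 0" shows "emeasure (halfline_measure G) {0..t} = ennreal (G t)"
proof -
  let ?M = "halfline_measure G"
  have Ioc: "emeasure ?M {a<..b} = ennreal (halfline_cdf G b - halfline_cdf G a)" if "a \<le> b" for a b
    unfolding halfline_measure_def
    using that halfline_cdf_mono halfline_cdf_right_cont by (intro emeasure_interval_measure_Ioc)
  have sets: "sets ?M = sets borel" by (simp add: halfline_measure_def)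
  have "(\<Union>n. {-1<..- 1 / (real n + 1)}) \<in> null_sets ?M"
  proof (rule null_sets_UN')
    fix n :: nat
    have "emeasure ?M {-1<..- 1 / (real n + 1)} = 0"
      by (subst Ioc) (auto simp: halfline_cdf_def field_simps)
    then show "{-1<..- 1 / (real n + 1)} \<in> null_sets ?M" using sets by (auto simp: null_sets_def)
  qed auto
  also have "(\<Union>n. {-1<..- 1 / (real n + 1)}) = {-1<..<0::real}"
  proof safe
    fix x :: real assume x: "x \<in> {-1<..<0}"
    then obtain n where "1 / (- x) < real n" using reals_Archimedean2 by blast
    then have "x \<le> - 1 / (real n + 1)" using x by (auto simp: field_simps)
    then show "x \<in> (\<Union>n. {-1<..- 1 / (real n + 1)})" using x by auto
  next
    fix x n assume "x \<in> {-1<..- 1 / (real n + 1)}"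
    moreover have "- 1 / (real n + 1) < 0" by (simp add: field_simps)
    ultimately show "x \<in> {-1<..<0}" unfolding greaterThanAtMost_iff greaterThanLessThan_iff by linarith
  qed
  finally have null: "{-1<..<0} \<in> null_sets ?M" .
  have "emeasure ?M ({0..t} \<union> {-1<..<0}) = emeasure ?M {0..t}"
    using sets null by (intro emeasure_Un_null_set) auto
  moreover have "{0..t} \<union> {-1<..<0} = {-1<..t}" using assms by auto
  ultimately show ?thesis using Ioc [of "-1" t] assms by (simp add: halfline_cdf_def)
qed

lemma emeasure_halfline_measure_neg: "emeasure (halfline_measure G) {..<0} = 0"
proof -
  let ?M = "halfline_measure G"
  have sets: "sets ?M = sets borel" by (simp add: halfline_measure_def)
  have "(\<Union>n. {- real n - 1<..- 1 / (real n + 1)}) \<in> null_sets ?M"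
  proof (rule null_sets_UN')
    fix n :: nat
    have "- real n - 1 \<le> - 1 / (real n + 1)" by (simp add: field_simps)
    then have "emeasure ?M {- real n - 1<..- 1 / (real n + 1)} = 0"
      unfolding halfline_measure_def
      using halfline_cdf_mono halfline_cdf_right_cont
      by (subst emeasure_interval_measure_Ioc) (auto simp: halfline_cdf_def field_simps)
    then show "{- real n - 1<..- 1 / (real n + 1)} \<in> null_sets ?M"
      using sets by (auto simp: null_sets_def)
  qed auto
  moreover have "{..<0::real} \<subseteq> (\<Union>n. {- real n - 1<..- 1 / (real n + 1)})"
  proof
    fix x :: real assume x: "x \<in> {..<0}"
    obtain n where n: "max (- x) (1 / (- x)) < real n" using reals_Archimedean2 by blast
    then have "x \<le> - 1 / (real n + 1)" using x by (auto simp: field_simps)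
    moreover have "- real n - 1 < x" using n by simp
    ultimately have "x \<in> {- real n - 1<..- 1 / (real n + 1)}" by simp
    then show "x \<in> (\<Union>n. {- real n - 1<..- 1 / (real n + 1)})" by blast
  qed
  ultimately have "{..<0} \<in> null_sets ?M" using sets by (elim null_sets_subset) auto
  then show ?thesis by auto
qed

end

text \<open>Both measures live on the half-line and are finite on bounded intervals, and their
  difference assigns \<open>F t\<close> to \<open>{0..t}\<close>.\<close>

lemma stieltjes_Icc:
  assumes F: "normalized_locally_BV F" and "t > 0"
  shows "emeasure (stieltjes_pos F) {0..t} = ennreal ((total_variation F t + F t) / 2)"
    and "emeasure (stieltjes_neg F) {0..t} = ennreal ((total_variation F t - F t) / 2)"
    and "emeasure (stieltjes_pos F) {..<0} = 0"
    and "emeasure (stieltjes_neg F) {..<0} = 0"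
    and "measure (stieltjes_pos F) {0..t} - measure (stieltjes_neg F) {0..t} = F t"
proof -
  let ?P = "\<lambda>t. (total_variation F t + F t) / 2" and ?N = "\<lambda>t. (total_variation F t - F t) / 2"
  have F0: "F 0 = 0" and Fc: "\<And>t. t > 0 \<Longrightarrow> continuous (at_right t) F"
    using F by (auto simp: normalized_locally_BV_def)
  note inc = total_variation_increment [OF F]
  have mono: "?P s \<le> ?P u" "?N s \<le> ?N u" if "0 \<le> s" "s \<le> u" for s u
    using inc [OF that] by auto
  have zero: "?P 0 = 0" "?N 0 = 0" by (auto simp: F0 total_variation_0 [OF F])
  have cont: "continuous (at_right u) ?P" "continuous (at_right u) ?N" if "u > 0" for u
    using total_variation_right_continuous [OF F that] Fc [OF that]
    by (auto intro!: continuous_intros)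
  show 1: "emeasure (stieltjes_pos F) {0..t} = ennreal (?P t)"
    unfolding stieltjes_pos_def
    by (rule emeasure_halfline_measure_Icc) (use mono zero cont \<open>t > 0\<close> in auto)
  show 2: "emeasure (stieltjes_neg F) {0..t} = ennreal (?N t)"
    unfolding stieltjes_neg_def
    by (rule emeasure_halfline_measure_Icc) (use mono zero cont \<open>t > 0\<close> in auto)
  show "emeasure (stieltjes_pos F) {..<0} = 0"
    unfolding stieltjes_pos_def
    by (rule emeasure_halfline_measure_neg) (use mono zero cont in auto)
  show "emeasure (stieltjes_neg F) {..<0} = 0"
    unfolding stieltjes_neg_def
    by (rule emeasure_halfline_measure_neg) (use mono zero cont in auto)
  have "0 \<le> ?P t" "0 \<le> ?N t" using mono [of 0 t] zero \<open>t > 0\<close> by auto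
  with 1 2 show "measure (stieltjes_pos F) {0..t} - measure (stieltjes_neg F) {0..t} = F t"
    by (simp add: measure_def field_simps)
qed

end

theory Submission
  imports Defs
begin

text \<open>
  Write \<open>f y\<close> for the Stieltjes integral of \<open>\<tau> \<mapsto> S (t - \<tau>) q y\<close> over \<open>{0..t}\<close>. By the hypothesis on
  \<open>weak_topology B\<close>, the linear map \<open>f\<close> is weakly continuous as soon as it is weakly sequentially
  continuous, and a weakly continuous functional is represented by an element of the diamond space
  (\<open>weak_continuous_functional_representable\<close>). So only sequential continuity has to be shown.

  For each fixed \<open>\<tau>\<close> the integrand is \<open>B (K \<tau>) y\<close> for some vector \<open>K \<tau>\<close>, because \<open>S (t - \<tau>)\<close> is a
  twin operator; hence the integrand converges pointwise along every weakly convergent sequence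
  \<open>x\<close>. Since the pairing is norming and the diamond space is complete, the uniform boundedness
  principle makes \<open>x\<close> bounded in norm (\<open>weakly_pointwise_bounded_imp_bounded\<close>). The exponential bound
  on \<open>S\<close> then gives a constant dominating the integrands, which is integrable because the positive
  and the negative variation measures of \<open>F\<close> are finite on \<open>{0..t}\<close>, and dominated convergence
  applies (\<open>set_integral_pairing_seq_continuous\<close>).
\<close>

section \<open>Uniform boundedness\<close>

text \<open>The Banach-Steinhaus theorem: the closed sets on which all the maps are bounded by \<open>k\<close>
  exhaust the space, so by Baire's theorem one of them contains a ball, and linearity transports
  the bound from that ball to the whole space.\<close>

lemma uniform_boundedness:
  fixes \<phi> :: "'i \<Rightarrow> 'a::banach \<Rightarrow> 'b::real_normed_vector"
  assumes lin: "\<And>i. bounded_linear (\<phi> i)"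
    and bdd: "\<And>x. \<exists>b. \<forall>i. norm (\<phi> i x) \<le> b"
  obtains C where "\<And>i x. norm (\<phi> i x) \<le> C * norm x"
proof -
  define T where "T k = {x. \<forall>i. norm (\<phi> i x) \<le> real k}" for k
  have clo: "closed (T k)" for k
  proof -
    have "continuous_on UNIV (\<lambda>x. norm (\<phi> i x))" for i
      by (intro continuous_on_norm linear_continuous_on lin)
    then have "closed {x. norm (\<phi> i x) \<le> real k}" for i
      by (intro closed_Collect_le) auto
    then have "closed (\<Inter>i. {x. norm (\<phi> i x) \<le> real k})" by (intro closed_INT) auto
    moreover have "(\<Inter>i. {x. norm (\<phi> i x) \<le> real k}) = T k" by (auto simp: T_def)
    ultimately show ?thesis by simp
  qed
  have cover: "\<Union>(range T) = UNIV"
  proof -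
    have "\<exists>k. x \<in> T k" for x
    proof -
      obtain b where b: "\<forall>i. norm (\<phi> i x) \<le> b" using bdd by blast
      obtain k where "b \<le> real k" using real_arch_simple by blast
      with b have "x \<in> T k" unfolding T_def by (auto intro: order_trans)
      then show ?thesis by blast
    qed
    then show ?thesis by blast
  qed
  have "\<exists>k. interior (T k) \<noteq> {}"
  proof (rule ccontr)
    assume "\<not> (\<exists>k. interior (T k) \<noteq> {})"
    then have "euclidean interior_of \<Union>(range T) = {}"
      using clo completely_metrizable_space_euclidean
      by (intro Baire_category_alt) (auto simp: interior_of_eq_empty)
    then show False by (simp add: cover)
  qed
  then obtain k a where "a \<in> interior (T k)" by blast
  then obtain r where r: "r > 0" "cball a r \<subseteq> T k" by (auto simp: mem_interior_cball)
  have "norm (\<phi> i x) \<le> 2 * real k / r * norm x" for i x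
  proof (cases "x = 0")
    case True
    then show ?thesis using lin by (simp add: linear_0 bounded_linear.linear)
  next
    case False
    interpret bounded_linear "\<phi> i" by (rule lin)
    \<comment> \<open>\<open>x\<close> is scaled to length \<open>r\<close> and written as a difference of two points of the ball\<close>
    define v where "v = (r / norm x) *\<^sub>R x"
    have "norm v = r" using r False by (simp add: v_def)
    then have "a + v \<in> T k" "a \<in> T k" using r by (auto simp: subset_iff dist_norm)
    then have "norm (\<phi> i (a + v)) \<le> real k" "norm (\<phi> i a) \<le> real k" by (auto simp: T_def)
    then have "norm (\<phi> i (a + v) - \<phi> i a) \<le> 2 * real k"
      using norm_triangle_ineq4 [of "\<phi> i (a + v)" "\<phi> i a"] by linarith
    moreover have "\<phi> i (a + v) - \<phi> i a = (r / norm x) *\<^sub>R \<phi> i x" by (simp add: add v_def scaleR)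
    ultimately show ?thesis using r False by (simp add: field_simps)
  qed
  then show thesis by (rule that)
qed

text \<open>The \<open>x i\<close> are regarded as bounded functionals \<open>\<lambda>y'. B y' (x i)\<close> on the complete diamond space; the
  norming property identifies the norm of such a functional with the norm of \<open>x i\<close>.\<close>

lemma weakly_pointwise_bounded_imp_bounded:
  assumes B: "norming_dual_pair B"
    and bdd: "\<And>y'. \<exists>b. \<forall>i. \<bar>B y' (x i)\<bar> \<le> b"
  obtains C where "\<And>i. norm (x i) \<le> C"
proof -
  obtain M where bil: "bilinear B" and M: "\<And>y' y. \<bar>B y' y\<bar> \<le> M * norm y' * norm y"
    and norm: "\<And>y. norm y = (SUP y'\<in>{y'. norm y' \<le> 1}. \<bar>B y' y\<bar>)"
    using B unfolding norming_dual_pair_def by blast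
  have "bounded_linear (\<lambda>y'. B y' (x i))" for i
    using bil M [of _ "x i"]
    by (intro bounded_linear_intro [where K = "M * norm (x i)"])
       (auto simp: bilinear_def linear_iff mult_ac)
  then obtain C where C: "\<And>i y'. norm (B y' (x i)) \<le> C * norm y'"
    using uniform_boundedness [of "\<lambda>i y'. B y' (x i)"] bdd by auto
  have "norm (x i) \<le> \<bar>C\<bar>" for i
  proof -
    have "norm (x i) = (SUP y'\<in>{y'. norm y' \<le> 1}. \<bar>B y' (x i)\<bar>)"
      by (rule norm)
    also have "\<dots> \<le> \<bar>C\<bar>"
    proof (rule cSUP_least)
      show "{y'. norm y' \<le> (1::real)} \<noteq> {}" by (auto intro: exI [of _ 0])
      fix y' :: 'a assume "y' \<in> {y'. norm y' \<le> 1}"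
      then have "\<bar>C\<bar> * norm y' \<le> \<bar>C\<bar>" by (simp add: mult_left_le)
      moreover have "C * norm y' \<le> \<bar>C\<bar> * norm y'" by (simp add: mult_right_mono)
      ultimately show "\<bar>B y' (x i)\<bar> \<le> \<bar>C\<bar>" using C [of y' i] by simp
    qed
    finally show ?thesis .
  qed
  then show thesis by (rule that)
qed

section \<open>Functionals that are continuous for the weak topology\<close>

lemma topspace_weak_topology [simp]: "topspace (weak_topology B) = UNIV"
  unfolding weak_topology_def topology_generated_by_topspace by blast

lemma continuous_map_pairing: "continuous_map (weak_topology B) euclideanreal (B y')"
  unfolding continuous_map_def weak_topology_def
  by (auto intro!: topology_generated_by_Basis) blast+

lemma weak_limit_pairing:
  assumes "limitin (weak_topology B) x l sequentially"
  shows "(\<lambda>n. B y' (x n)) \<longlonglongrightarrow> B y' l"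
  using continuous_map_limit [OF continuous_map_pairing assms, of y'] by (simp add: o_def)

lemma weak_open_contains_basic_nhd:
  assumes "openin (weak_topology B) V" and "x \<in> V"
  shows "\<exists>A e. finite A \<and> e > 0 \<and> {y. \<forall>a\<in>A. \<bar>B a y - B a x\<bar> < e} \<subseteq> V"
proof -
  have "generate_topology_on {{y. B y' y \<in> U} | y' U. open U} V"
    using assms(1) unfolding weak_topology_def by (rule openin_topology_generated_by)
  then show ?thesis using \<open>x \<in> V\<close>
  proof induction
    case (Int V W)
    then have "x \<in> V" "x \<in> W" by auto
    from Int.IH(1) [OF \<open>x \<in> V\<close>] obtain A e
      where "finite A" "e > 0" "{y. \<forall>a\<in>A. \<bar>B a y - B a x\<bar> < e} \<subseteq> V" by blast
    moreover from Int.IH(2) [OF \<open>x \<in> W\<close>] obtain A' e'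
      where "finite A'" "e' > 0" "{y. \<forall>a\<in>A'. \<bar>B a y - B a x\<bar> < e'} \<subseteq> W" by blast
    ultimately
    show ?case by (intro exI [of _ "A \<union> A'"] exI [of _ "min e e'"]) auto
  next
    case (UN \<V>)
    then obtain V where "V \<in> \<V>" "x \<in> V" by blast
    then obtain A e where "finite A" "e > 0" "{y. \<forall>a\<in>A. \<bar>B a y - B a x\<bar> < e} \<subseteq> V"
      using UN.IH by blast
    then show ?case using \<open>V \<in> \<V>\<close> by blast
  next
    case (Basis V)
    then obtain a U where V: "V = {y. B a y \<in> U}" and "open U" by blast
    then obtain e where "e > 0" "ball (B a x) e \<subseteq> U"
      using Basis by (auto simp: open_contains_ball)
    then show ?case
      by (intro exI [of _ "{a}"] exI [of _ e]) (auto simp: V subset_iff dist_real_def abs_minus_commute)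
  qed auto
qed

text \<open>The induction removes one functional at a time: if \<open>B a\<close> does not already vanish on the joint
  kernel of the others, some \<open>z\<close> in that kernel has \<open>B a z = 1\<close>, and subtracting \<open>f z\<close> times \<open>B a\<close>
  from \<open>f\<close> gives a functional that vanishes on the larger kernel.\<close>

lemma functional_vanishing_on_kernels_representable:
  fixes f :: "'y::real_vector \<Rightarrow> real" and B :: "'d::real_vector \<Rightarrow> 'y \<Rightarrow> real"
  assumes "bilinear B" and "finite A" and "linear f"
    and "\<And>y. (\<And>a. a \<in> A \<Longrightarrow> B a y = 0) \<Longrightarrow> f y = 0"
  shows "\<exists>u. \<forall>y. f y = B u y"
  using assms(2-4)
proof (induction A arbitrary: f)
  case empty
  then show ?case using bilinear_lzero [OF \<open>bilinear B\<close>] by (intro exI [of _ 0]) auto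
next
  case (insert a A)
  have lB: "linear (B b)" for b using \<open>bilinear B\<close> by (simp add: bilinear_def)
  show ?case
  proof (cases "\<exists>z. (\<forall>b\<in>A. B b z = 0) \<and> B a z \<noteq> 0")
    case False
    then show ?thesis
      by (intro insert.IH \<open>linear f\<close> insert.prems) (metis insert_iff)
  next
    case True
    then obtain z' where z': "\<forall>b\<in>A. B b z' = 0" "B a z' \<noteq> 0" by blast
    define z where "z = (1 / B a z') *\<^sub>R z'"
    have z: "\<And>b. b \<in> A \<Longrightarrow> B b z = 0" "B a z = 1"
      using z' by (auto simp: z_def linear_scale [OF lB])
    have "\<exists>u. \<forall>y. f y - f z * B a y = B u y"
    proof (rule insert.IH)
      show "linear (\<lambda>y. f y - f z * B a y)"
        using \<open>linear f\<close> lB [of a] by (auto simp: linear_iff algebra_simps)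
      fix y assume y: "\<And>b. b \<in> A \<Longrightarrow> B b y = 0"
      have "f (y - B a y *\<^sub>R z) = 0"
        using y z by (intro insert.prems) (auto simp: linear_diff [OF lB] linear_scale [OF lB])
      then show "f y - f z * B a y = 0"
        by (simp add: linear_diff [OF \<open>linear f\<close>] linear_scale [OF \<open>linear f\<close>])
    qed
    then obtain u where "\<And>y. B u y = f y - f z * B a y" by metis
    then have "f y = B (u + f z *\<^sub>R a) y" for y
      by (simp add: bilinear_ladd [OF \<open>bilinear B\<close>] bilinear_lmul [OF \<open>bilinear B\<close>])
    then show ?thesis by blast
  qed
qed

text \<open>Continuity at \<open>0\<close> bounds \<open>f\<close> on a basic neighbourhood, which contains the joint kernel of
  finitely many functionals \<open>B a\<close>; a linear map bounded on a subspace vanishes there.\<close>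

lemma weak_continuous_functional_representable:
  assumes "bilinear B" and "linear f"
    and "continuous_map (weak_topology B) euclideanreal f"
  shows "\<exists>u. \<forall>y. f y = B u y"
proof -
  have lB: "linear (B b)" for b using \<open>bilinear B\<close> by (simp add: bilinear_def)
  have "openin (weak_topology B) {y \<in> topspace (weak_topology B). f y \<in> ball 0 1}"
    using assms(3) by (rule openin_continuous_map_preimage) simp
  then obtain A e where A: "finite A" "e > 0"
      and sub: "{y. \<forall>a\<in>A. \<bar>B a y - B a 0\<bar> < e} \<subseteq> {y. \<bar>f y\<bar> < 1}"
    using weak_open_contains_basic_nhd [of B "{y. \<bar>f y\<bar> < 1}" 0]
    by (auto simp: linear_0 [OF \<open>linear f\<close>])
  have "f y = 0" if y: "\<And>a. a \<in> A \<Longrightarrow> B a y = 0" for y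
  proof (rule ccontr)
    assume "f y \<noteq> 0"
    have "\<bar>f ((1 / f y) *\<^sub>R y)\<bar> < 1"
      using sub y \<open>e > 0\<close> by (auto simp: subset_iff linear_scale [OF lB] linear_0 [OF lB])
    then show False using \<open>f y \<noteq> 0\<close> by (simp add: linear_scale [OF \<open>linear f\<close>])
  qed
  then show ?thesis
    using functional_vanishing_on_kernels_representable [OF assms(1) A(1) assms(2)] by blast
qed

section \<open>Integrating a bounded family of pairings\<close>

text \<open>The vectors \<open>K \<tau>\<close> come from the pointwise existence clause of a twin operator, so measurability
  is asked of the scalar functions \<open>\<tau> \<mapsto> B (K \<tau>) y\<close> only. The integral of \<open>K\<close> itself may then have
  no meaning in the diamond space, which is why a representing vector has to be obtained from
  weak continuity.\<close>

context
  fixes B :: "'d::real_vector \<Rightarrow> 'y::real_normed_vector \<Rightarrow> real"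
    and K :: "'m \<Rightarrow> 'd" and M :: "'m measure" and A C
  assumes B: "bilinear B"
    and A: "A \<in> sets M" "emeasure M A < \<infinity>"
    and meas: "\<And>y. set_borel_measurable M A (\<lambda>\<tau>. B (K \<tau>) y)"
    and bound: "\<And>\<tau> y. \<tau> \<in> A \<Longrightarrow> \<bar>B (K \<tau>) y\<bar> \<le> C * norm y"
begin

lemma set_integrable_pairing: "set_integrable M A (\<lambda>\<tau>. B (K \<tau>) y)"
  unfolding set_integrable_def
  by (rule integrableI_bounded_set [where A = A and B = "C * norm y"])
     (use A meas bound in \<open>auto simp: set_borel_measurable_def\<close>)

lemma linear_set_integral_pairing: "linear (\<lambda>y. LINT \<tau>:A|M. B (K \<tau>) y)"
proof (rule linearI)
  fix y z show "(LINT \<tau>:A|M. B (K \<tau>) (y + z)) = (LINT \<tau>:A|M. B (K \<tau>) y) + (LINT \<tau>:A|M. B (K \<tau>) z)"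
    by (simp add: bilinear_radd [OF B] set_integrable_pairing)
next
  fix c y show "(LINT \<tau>:A|M. B (K \<tau>) (c *\<^sub>R y)) = c *\<^sub>R (LINT \<tau>:A|M. B (K \<tau>) y)"
    by (simp add: bilinear_rmul [OF B])
qed

lemma set_integral_pairing_seq_continuous:
  assumes bdd: "\<And>n. norm (x n) \<le> D"
    and conv: "\<And>y'. (\<lambda>n. B y' (x n)) \<longlonglongrightarrow> B y' l"
  shows "(\<lambda>n. LINT \<tau>:A|M. B (K \<tau>) (x n)) \<longlonglongrightarrow> (LINT \<tau>:A|M. B (K \<tau>) l)"
  unfolding set_lebesgue_integral_def
proof (rule integral_dominated_convergence [where w = "\<lambda>\<tau>. indicator A \<tau> *\<^sub>R (\<bar>C\<bar> * D)"])
  show "integrable M (\<lambda>\<tau>. indicator A \<tau> *\<^sub>R (\<bar>C\<bar> * D))" using A by (intro integrable_scaleR_left) auto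
  have "\<bar>B (K \<tau>) (x n)\<bar> \<le> \<bar>C\<bar> * D" if "\<tau> \<in> A" for \<tau> n
  proof -
    have "C * norm (x n) \<le> \<bar>C\<bar> * D" using bdd by (intro mult_mono) auto
    then show ?thesis using bound [OF that, of "x n"] by simp
  qed
  then show "AE \<tau> in M. norm (indicator A \<tau> *\<^sub>R B (K \<tau>) (x n)) \<le> indicator A \<tau> *\<^sub>R (\<bar>C\<bar> * D)" for n
    by (auto simp: indicator_def)
  show "AE \<tau> in M. (\<lambda>n. indicator A \<tau> *\<^sub>R B (K \<tau>) (x n)) \<longlonglongrightarrow> indicator A \<tau> *\<^sub>R B (K \<tau>) l"
    by (intro AE_I2 tendsto_scaleR tendsto_const conv)
qed (use meas in \<open>auto simp: set_borel_measurable_def\<close>)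

end

section \<open>Convolving a twin semigroup with a function of bounded variation\<close>

theorem lemma8p4:
  fixes B :: "'d::banach \<Rightarrow> 'y::banach \<Rightarrow> real"
    and S :: "real \<Rightarrow> 'd \<Rightarrow> 'y \<Rightarrow> real"
    and q :: 'd
    and F :: "real \<Rightarrow> real"
  assumes "norming_dual_pair B"
    and "twin_semigroup B S"
    and "\<And>f :: 'y \<Rightarrow> real. linear f \<Longrightarrow>
           sequentially_continuous_map (weak_topology B) euclideanreal f \<Longrightarrow>
           continuous_map (weak_topology B) euclideanreal f"
    and "normalized_locally_BV F"
  shows "\<forall>t>0. \<exists>u :: 'd. \<forall>y. stieltjes_integral F {0..t} (\<lambda>\<tau>. S (t - \<tau>) q y) = B u y"
proof (intro allI impI)
  fix t :: real assume "t > 0"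
  let ?P = "stieltjes_pos F" and ?N = "stieltjes_neg F"
  let ?f = "\<lambda>y. stieltjes_integral F {0..t} (\<lambda>\<tau>. S (t - \<tau>) q y)"
  have B: "bilinear B" using assms(1) unfolding norming_dual_pair_def by blast
  have "\<exists>z'. \<forall>y. S s q y = B z' y" if "s \<ge> 0" for s
    using assms(2) that unfolding twin_semigroup_def twin_operator_def by metis
  then have "\<forall>\<tau>. \<exists>z'. \<tau> \<in> {0..t} \<longrightarrow> (\<forall>y. S (t - \<tau>) q y = B z' y)" by simp
  then obtain K where K: "\<And>\<tau> y. \<tau> \<in> {0..t} \<Longrightarrow> S (t - \<tau>) q y = B (K \<tau>) y" by metis
  have sets: "sets ?P = sets borel" "sets ?N = sets borel"
    by (simp_all add: stieltjes_pos_def stieltjes_neg_def halfline_measure_def)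
  then have A: "{0..t} \<in> sets ?P" "{0..t} \<in> sets ?N" by auto
  have fin: "emeasure ?P {0..t} < \<infinity>" "emeasure ?N {0..t} < \<infinity>"
    using stieltjes_Icc [OF assms(4) \<open>t > 0\<close>] by auto

  have "(\<lambda>\<tau>. indicator {0..t} \<tau> *\<^sub>R B (K \<tau>) y) \<in> borel_measurable borel" for y
  proof -
    have "(\<lambda>s. indicator {0..} s *\<^sub>R S s q y) \<in> borel_measurable borel"
      using assms(2) by (auto simp: twin_semigroup_def set_borel_measurable_def)
    then have "(\<lambda>\<tau>. indicator {0..} (t - \<tau>) *\<^sub>R S (t - \<tau>) q y) \<in> borel_measurable borel"
      by (rule measurable_compose [rotated]) simp
    then have "(\<lambda>\<tau>. indicator {0..t} \<tau> *\<^sub>R (indicator {0..} (t - \<tau>) *\<^sub>R S (t - \<tau>) q y))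
        \<in> borel_measurable borel"
      by (rule borel_measurable_scaleR [rotated]) simp
    also have "(\<lambda>\<tau>. indicator {0..t} \<tau> *\<^sub>R (indicator {0..} (t - \<tau>) *\<^sub>R S (t - \<tau>) q y))
        = (\<lambda>\<tau>. indicator {0..t} \<tau> *\<^sub>R B (K \<tau>) y)"
      using K by (auto simp: indicator_def fun_eq_iff)
    finally show ?thesis .
  qed
  then have meas: "set_borel_measurable ?P {0..t} (\<lambda>\<tau>. B (K \<tau>) y)"
      "set_borel_measurable ?N {0..t} (\<lambda>\<tau>. B (K \<tau>) y)" for y
    unfolding set_borel_measurable_def measurable_cong_sets [OF sets(1) refl]
      measurable_cong_sets [OF sets(2) refl] by auto

  obtain M \<omega> where M: "M \<ge> 1"
      "\<And>s y' y. s \<ge> 0 \<Longrightarrow> \<bar>S s y' y\<bar> \<le> M * exp (\<omega> * s) * norm y * norm y'"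
    using assms(2) unfolding twin_semigroup_def by (elim conjE exE) (rule that, assumption, fast)
  \<comment> \<open>the absolute value makes the bound increasing in the time, so that it covers all of \<open>{0..t}\<close>\<close>
  define C where "C = M * exp (\<bar>\<omega>\<bar> * t) * norm q"
  have bound: "\<bar>B (K \<tau>) y\<bar> \<le> C * norm y" if "\<tau> \<in> {0..t}" for \<tau> y
  proof -
    have "\<omega> * (t - \<tau>) \<le> \<bar>\<omega>\<bar> * t" using that by (intro mult_mono) auto
    then have "M * exp (\<omega> * (t - \<tau>)) * norm y * norm q \<le> M * exp (\<bar>\<omega>\<bar> * t) * norm y * norm q"
      using M(1) by (intro mult_right_mono mult_left_mono) auto
    then show ?thesis
      using M(2) [of "t - \<tau>" q y] K [OF that, of y] that by (simp add: C_def mult_ac)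
  qed

  have f: "?f y = (LINT \<tau>:{0..t}|?P. B (K \<tau>) y) - (LINT \<tau>:{0..t}|?N. B (K \<tau>) y)" for y
    unfolding stieltjes_integral_def
    using A K by (intro arg_cong2 [where f = minus] set_lebesgue_integral_cong) auto
  have lin: "linear ?f"
    unfolding f
    by (intro linear_compose_sub linear_set_integral_pairing [OF B A(1) fin(1) meas(1) bound]
        linear_set_integral_pairing [OF B A(2) fin(2) meas(2) bound])
  have "sequentially_continuous_map (weak_topology B) euclideanreal ?f"
    unfolding sequentially_continuous_map_def
  proof (intro conjI allI impI)
    fix x :: "nat \<Rightarrow> 'y" and l
    assume "(\<forall>n. x n \<in> topspace (weak_topology B)) \<and> limitin (weak_topology B) x l sequentially"
    then have conv: "(\<lambda>n. B y' (x n)) \<longlonglongrightarrow> B y' l" for y'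
      by (elim conjE weak_limit_pairing)
    then have "\<exists>b. \<forall>n. \<bar>B y' (x n)\<bar> \<le> b" for y'
      using convergent_imp_Bseq [OF convergentI [OF conv [of y']]] by (auto simp: Bseq_def)
    then obtain D where D: "\<And>n. norm (x n) \<le> D"
      using weakly_pointwise_bounded_imp_bounded [OF assms(1)] by blast
    have "(\<lambda>n. ?f (x n)) \<longlonglongrightarrow> ?f l"
      unfolding f
      by (intro tendsto_diff
          set_integral_pairing_seq_continuous [OF B A(1) fin(1) meas(1) bound D conv]
          set_integral_pairing_seq_continuous [OF B A(2) fin(2) meas(2) bound D conv])
    then show "limitin euclideanreal (\<lambda>n. ?f (x n)) (?f l) sequentially" by simp
  qed auto
  then have "continuous_map (weak_topology B) euclideanreal ?f" by (intro assms(3) lin)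
  then show "\<exists>u. \<forall>y. ?f y = B u y"
    by (rule weak_continuous_functional_representable [OF B lin])
qed

end
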